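(* Let $\mathcal{L}$ be an interval greedoid on a finite alphabet $E$. Then $\mathcal{L}$ with the composition $\circ$ is an LRB semigroup (with identity the empty word). Moreover its poset of flats $\Phi$ is its support lattice, with support map $\mathcal{L}\to\Phi$, $\alpha\mapsto[\alpha]$; that is, $\Phi$ is a lattice, $\alpha\mapsto[\alpha]$ is order-preserving and surjective, and for all $\alpha,\beta\in\mathcal{L}$: $[\alpha\circ\beta]=[\alpha]\vee[\beta]$, and $[\beta]\le[\alpha]$ if and only if $\alpha\circ\beta=\alpha$.
   Context: $E^*$ is the set of words $x_1x_2\cdots x_k$ with distinct letters from $E$. A greedoid is $\mathcal{L}\subseteq E^*$ such that (G1) $\alpha\beta\in\mathcal{L}\Rightarrow\alpha\in\mathcal{L}$, and (G2) if $\alpha,\beta\in\mathcal{L}$ with $|\alpha|>|\beta|$ then $\alpha$ contains a letter $x$ with $\beta x\in\mathcal{L}$. It is an interval greedoid if (G1) holds together with (G3): if $\alpha,\beta\in\mathcal{L}$ and $|\alpha|>|\beta|$ then $\alpha$ contains a subword $\gamma$ (obtained by deleting letters) of length $|\alpha|-|\beta|$ with $\beta\gamma\in\mathcal{L}$. Composition: for $\alpha\in\mathcal{L}$ and $y_1\cdots y_k\in\mathcal{L}$, $\alpha\circ y_1\cdots y_k$ is obtained starting from $\alpha$ by processing $y_1,\dots,y_k$ from left to right and appending $y_i$ to the current word exactly when the result stays in $\mathcal{L}$. Flats: $\alpha\sim\beta$ iff $\{\gamma:\alpha\gamma\in\mathcal{L}\}=\{\gamma:\beta\gamma\in\mathcal{L}\}$;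 $\Phi=\mathcal{L}/\sim$ ordered by $[\alpha]\le[\beta]$ iff $\alpha\gamma\sim\beta$ for some $\gamma\in E^*$. An LRB semigroup is a finite semigroup with identity satisfying $x^2=x$ and $xyx=xy$; it is ordered by $x\le y\iff xy=y$. *)

theory Defs
  imports "HOL-Algebra.Lattice" "HOL-Algebra.Group" "HOL-Library.Sublist"
begin

definition words :: "'a set \<Rightarrow> 'a list set" where
  "words E = {w. distinct w \<and> set w \<subseteq> E}"

text \<open>
  As usual for greedoids, the language is nonempty, so that by (G1) it contains the empty word;
  without this there would be no identity for the composition. The last assumption is (G3),
  and \<open>subseq \<gamma> \<alpha>\<close> says that \<open>\<gamma>\<close> arises from \<open>\<alpha>\<close> by deleting letters.
\<close>

locale interval_greedoid =
  fixes E :: "'a set" and L :: "'a list set"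
  assumes language: "L \<subseteq> words E"
    and nonempty: "L \<noteq> {}"
    and prefix_closed: "\<And>\<alpha> \<beta>. \<alpha> @ \<beta> \<in> L \<Longrightarrow> \<alpha> \<in> L"
    and strong_exchange: "\<And>\<alpha> \<beta>. \<alpha> \<in> L \<Longrightarrow> \<beta> \<in> L \<Longrightarrow> length \<alpha> > length \<beta> \<Longrightarrow>
      \<exists>\<gamma>. subseq \<gamma> \<alpha> \<and> length \<gamma> = length \<alpha> - length \<beta> \<and> \<beta> @ \<gamma> \<in> L"

definition greedoid_comp :: "'a list set \<Rightarrow> 'a list \<Rightarrow> 'a list \<Rightarrow> 'a list" where
  "greedoid_comp L \<alpha> \<beta> = foldl (\<lambda>w y. if w @ [y] \<in> L then w @ [y] else w) \<alpha> \<beta>"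

definition greedoid_monoid :: "'a list set \<Rightarrow> 'a list monoid" where
  "greedoid_monoid L = \<lparr>carrier = L, mult = greedoid_comp L, one = []\<rparr>"

definition continuations :: "'a set \<Rightarrow> 'a list set \<Rightarrow> 'a list \<Rightarrow> 'a list set" where
  "continuations E L \<alpha> = {\<gamma> \<in> words E. \<alpha> @ \<gamma> \<in> L}"

definition flat_rel :: "'a set \<Rightarrow> 'a list set \<Rightarrow> ('a list \<times> 'a list) set" where
  "flat_rel E L = {(\<alpha>, \<beta>). \<alpha> \<in> L \<and> \<beta> \<in> L \<and> continuations E L \<alpha> = continuations E L \<beta>}"

definition flat_of :: "'a set \<Rightarrow> 'a list set \<Rightarrow> 'a list \<Rightarrow> 'a list set" where
  "flat_of E L \<alpha> = flat_rel E L `` {\<alpha>}"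

definition flat_le :: "'a set \<Rightarrow> 'a list set \<Rightarrow> 'a list set \<Rightarrow> 'a list set \<Rightarrow> bool" where
  "flat_le E L X Y \<longleftrightarrow> (\<exists>\<alpha>\<in>L. \<exists>\<beta>\<in>L. X = flat_of E L \<alpha> \<and> Y = flat_of E L \<beta> \<and>
     (\<exists>\<gamma>\<in>words E. (\<alpha> @ \<gamma>, \<beta>) \<in> flat_rel E L))"

definition flat_poset :: "'a set \<Rightarrow> 'a list set \<Rightarrow> 'a list set gorder" where
  "flat_poset E L = \<lparr>carrier = L // flat_rel E L, eq = (=), le = flat_le E L\<rparr>"

lemma equiv_flat_rel: "equiv L (flat_rel E L)"
  by (auto simp: flat_rel_def intro!: equivI refl_onI symI transI)

lemma flat_of_eq_iff:
  assumes "\<alpha> \<in> L" "\<beta> \<in> L"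
  shows "flat_of E L \<alpha> = flat_of E L \<beta> \<longleftrightarrow> (\<alpha>, \<beta>) \<in> flat_rel E L"
  unfolding flat_of_def using eq_equiv_class_iff[OF equiv_flat_rel assms] .

text \<open>The order on flats does not depend on the chosen representatives.\<close>

lemma flat_le_flat_of_iff:
  assumes "L \<subseteq> words E" "\<alpha> \<in> L" "\<beta> \<in> L"
  shows "flat_le E L (flat_of E L \<alpha>) (flat_of E L \<beta>) \<longleftrightarrow>
    (\<exists>\<gamma>\<in>words E. (\<alpha> @ \<gamma>, \<beta>) \<in> flat_rel E L)" (is "?l \<longleftrightarrow> ?r")
proof
  assume ?r
  then show ?l using assms unfolding flat_le_def by blast
next
  assume ?l
  then obtain \<alpha>' \<beta>' \<gamma> where h: "\<alpha>' \<in> L" "\<beta>' \<in> L" "\<gamma> \<in> words E"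
    and a: "continuations E L \<alpha> = continuations E L \<alpha>'"
    and b: "continuations E L \<beta> = continuations E L \<beta>'"
    and c: "(\<alpha>' @ \<gamma>, \<beta>') \<in> flat_rel E L"
    unfolding flat_le_def using assms by (auto simp: flat_of_eq_iff) (auto simp: flat_rel_def)
  have iff: "\<alpha> @ \<delta> \<in> L \<longleftrightarrow> \<alpha>' @ \<delta> \<in> L" for \<delta>
  proof -
    have "\<delta> \<in> words E" if "\<rho> @ \<delta> \<in> L" for \<rho>
      using subsetD[OF assms(1) that] by (simp add: words_def)
    then show ?thesis using a by (auto simp: continuations_def set_eq_iff)
  qed
  have "continuations E L (\<alpha> @ \<gamma>) = continuations E L (\<alpha>' @ \<gamma>)"
    unfolding continuations_def by (simp add: iff)
  then have "(\<alpha> @ \<gamma>, \<beta>) \<in> flat_rel E L"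
    using b c iff[of \<gamma>] assms(3) by (simp add: flat_rel_def)
  then show ?r using h(3) by blast
qed

locale LRB_semigroup = monoid S for S (structure) +
  assumes finite_carrier: "finite (carrier S)"
    and idem: "x \<in> carrier S \<Longrightarrow> x \<otimes> x = x"
    and left_regular: "x \<in> carrier S \<Longrightarrow> y \<in> carrier S \<Longrightarrow> x \<otimes> y \<otimes> x = x \<otimes> y"

definition LRB_order :: "('a, 'b) monoid_scheme \<Rightarrow> 'a gorder" where
  "LRB_order S = \<lparr>carrier = carrier S, eq = (=), le = (\<lambda>x y. x \<otimes>\<^bsub>S\<^esub> y = y)\<rparr>"

definition support_lattice ::
  "('a, 'c) monoid_scheme \<Rightarrow> ('b, 'd) gorder_scheme \<Rightarrow> ('a \<Rightarrow> 'b) \<Rightarrow> bool" where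
  "support_lattice S \<Lambda> supp \<longleftrightarrow>
     lattice \<Lambda> \<and>
     isotone (LRB_order S) \<Lambda> supp \<and>
     supp ` carrier S = carrier \<Lambda> \<and>
     (\<forall>x\<in>carrier S. \<forall>y\<in>carrier S. supp (x \<otimes>\<^bsub>S\<^esub> y) = supp x \<squnion>\<^bsub>\<Lambda>\<^esub> supp y) \<and>
     (\<forall>x\<in>carrier S. \<forall>y\<in>carrier S. supp y \<sqsubseteq>\<^bsub>\<Lambda>\<^esub> supp x \<longleftrightarrow> x \<otimes>\<^bsub>S\<^esub> y = x)"

end

theory Submission
  imports Defs
begin

text \<open>
  Say that \<open>\<alpha>\<close> absorbs \<open>\<beta>\<close> if no letter of \<open>\<beta>\<close> can be appended to \<open>\<alpha>\<close>, which amounts to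
  \<open>\<alpha> \<circ> \<beta> = \<alpha>\<close>. By strong exchange, words of equal length one of which absorbs the other are
  equivalent, and a word absorbed by \<open>\<alpha>\<close> can be filled up with letters of \<open>\<alpha>\<close> to
  the length of \<open>\<alpha>\<close>; hence \<open>\<alpha>\<close> absorbs \<open>\<beta>\<close> exactly when \<open>[\<beta>] \<le> [\<alpha>]\<close>. As the letters of
  \<open>\<alpha> \<circ> \<beta>\<close> come from \<open>\<alpha>\<close> and \<open>\<beta>\<close>, its flat is the join. Associativity reduces to the
  interval property: a letter that can be appended to \<open>\<alpha>\<close> and to \<open>\<alpha>\<beta>\<gamma>\<close> can be appended
  to \<open>\<alpha>\<beta>\<close>. Meets exist because a common lower bound of maximal length absorbs all others.
\<close>

section \<open>Finiteness of the words and the order of an LRB semigroup\<close>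

lemma finite_words: "finite E \<Longrightarrow> finite (words E)"
  using finite_subset_distinct[of E] by (simp add: words_def conj_commute)

text \<open>\<open>isotone\<close> presupposes partial orders on both sides; this provides the
  source side.\<close>

lemma partial_order_LRB_order:
  assumes "LRB_semigroup S"
  shows "partial_order (LRB_order S)"
proof -
  interpret LRB_semigroup S by fact
  show ?thesis
  proof
    fix x y assume "x \<in> carrier (LRB_order S)" "y \<in> carrier (LRB_order S)"
      and "x \<sqsubseteq>\<^bsub>LRB_order S\<^esub> y" "y \<sqsubseteq>\<^bsub>LRB_order S\<^esub> x"
    \<comment> \<open>From xy = y and yx = x one gets x = yx = xyx = xy = y.\<close>
    then show "x .=\<^bsub>LRB_order S\<^esub> y"
      using left_regular[of x y] by (simp add: LRB_order_def)
  next
    fix x y z assume "x \<in> carrier (LRB_order S)" "y \<in> carrier (LRB_order S)"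
      "z \<in> carrier (LRB_order S)" and "x \<sqsubseteq>\<^bsub>LRB_order S\<^esub> y" "y \<sqsubseteq>\<^bsub>LRB_order S\<^esub> z"
    then show "x \<sqsubseteq>\<^bsub>LRB_order S\<^esub> z"
      using m_assoc[of x y z] by (simp add: LRB_order_def)
  qed (auto simp: LRB_order_def idem)
qed

section \<open>First consequences of the axioms\<close>

context interval_greedoid
begin

lemma distinct_if_mem: "\<alpha> \<in> L \<Longrightarrow> distinct \<alpha>"
  using language by (auto simp: words_def)

lemma words_if_append_mem: "\<alpha> @ \<gamma> \<in> L \<Longrightarrow> \<gamma> \<in> words E"
  using language by (fastforce simp: words_def)

lemma Nil_mem: "[] \<in> L"
  using nonempty prefix_closed[of "[]"] by auto

lemma flat_rel_iff:
  "(\<alpha>, \<beta>) \<in> flat_rel E L \<longleftrightarrow> \<alpha> \<in> L \<and> \<beta> \<in> L \<and> (\<forall>\<gamma>. \<alpha> @ \<gamma> \<in> L \<longleftrightarrow> \<beta> @ \<gamma> \<in> L)"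
  using words_if_append_mem by (auto simp: flat_rel_def continuations_def set_eq_iff)

text \<open>This is (G2): the first letter of the word supplied by (G3) can be appended by
  itself.\<close>

lemma exchange_letter:
  assumes "\<alpha> \<in> L" "\<beta> \<in> L" "length \<alpha> > length \<beta>"
  obtains x where "x \<in> set \<alpha>" "\<beta> @ [x] \<in> L"
proof -
  obtain \<gamma> where \<gamma>: "subseq \<gamma> \<alpha>" "length \<gamma> = length \<alpha> - length \<beta>" "\<beta> @ \<gamma> \<in> L"
    using strong_exchange[OF assms] by blast
  then obtain x \<gamma>' where "\<gamma> = x # \<gamma>'"
    using assms(3) by (cases \<gamma>) auto
  then show thesis
    using \<gamma> prefix_closed[of "\<beta> @ [x]" \<gamma>'] that[of x]
    by (auto dest: list_emb_set)
qed

section \<open>Absorption, the order on flats and the interval property\<close>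

definition absorbs :: "'a list \<Rightarrow> 'a list \<Rightarrow> bool" where
  "absorbs \<alpha> \<beta> \<longleftrightarrow> (\<forall>x\<in>set \<beta>. \<alpha> @ [x] \<notin> L)"

lemma absorbs_append_iff: "absorbs \<alpha> (\<beta> @ \<gamma>) \<longleftrightarrow> absorbs \<alpha> \<beta> \<and> absorbs \<alpha> \<gamma>"
  by (auto simp: absorbs_def)

text \<open>Words in \<open>L\<close> repeat no letter. The instance with an empty second part says
  that every word absorbs itself.\<close>

lemma absorbs_prefix: "absorbs (\<alpha> @ \<beta>) \<alpha>"
  using distinct_if_mem by (fastforce simp: absorbs_def)

lemma length_le_if_absorbs: "\<alpha> \<in> L \<Longrightarrow> \<beta> \<in> L \<Longrightarrow> absorbs \<alpha> \<beta> \<Longrightarrow> length \<beta> \<le> length \<alpha>"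
  using exchange_letter[of \<beta> \<alpha>] by (force simp: absorbs_def)

text \<open>Fill \<beta> up with letters of \<open>\<alpha> @ \<delta>\<close>. None of them comes
  from \<alpha>: appended to \<beta>, the first such letter would give a word absorbed by \<alpha>
  and longer than \<alpha>. So the added word is all of \<delta>.\<close>

lemma append_mem_if_absorbs_same_length:
  assumes "\<alpha> \<in> L" "\<beta> \<in> L" "length \<alpha> = length \<beta>" "absorbs \<alpha> \<beta>" "\<alpha> @ \<delta> \<in> L"
  shows "\<beta> @ \<delta> \<in> L"
proof (cases "\<delta> = []")
  case False
  then obtain \<gamma> where \<gamma>: "subseq \<gamma> (\<alpha> @ \<delta>)" "length \<gamma> = length \<delta>" "\<beta> @ \<gamma> \<in> L"
    using strong_exchange[OF assms(5,2)] assms(3) by auto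
  then obtain \<gamma>1 \<gamma>2 where split: "\<gamma> = \<gamma>1 @ \<gamma>2" "subseq \<gamma>1 \<alpha>" "subseq \<gamma>2 \<delta>"
    by (auto simp: subseq_append_iff)
  have "\<gamma>1 = []"
  proof (rule ccontr)
    assume "\<gamma>1 \<noteq> []"
    then obtain a \<gamma>' where a: "\<gamma>1 = a # \<gamma>'" by (cases \<gamma>1) auto
    then have "a \<in> set \<alpha>" using split(2) by (auto dest: list_emb_set)
    moreover have "\<beta> @ [a] \<in> L"
      using \<gamma>(3) prefix_closed[of "\<beta> @ [a]" "\<gamma>' @ \<gamma>2"] split a by simp
    ultimately show False
      using length_le_if_absorbs[OF assms(1), of "\<beta> @ [a]"] assms absorbs_prefix[of \<alpha> "[]"]
      by (auto simp: absorbs_def)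
  qed
  then have "\<gamma> = \<delta>" using split \<gamma>(2) subseq_same_length[of \<gamma>2 \<delta>] by simp
  then show ?thesis using \<gamma>(3) by simp
qed (use assms in simp)

lemma absorbs_sym_same_length:
  assumes "\<alpha> \<in> L" "\<beta> \<in> L" "length \<alpha> = length \<beta>" "absorbs \<alpha> \<beta>"
  shows "absorbs \<beta> \<alpha>"
  unfolding absorbs_def
proof (intro ballI notI)
  fix a assume "a \<in> set \<alpha>" "\<beta> @ [a] \<in> L"
  then show False
    using length_le_if_absorbs[OF assms(1), of "\<beta> @ [a]"] assms absorbs_prefix[of \<alpha> "[]"]
    by (auto simp: absorbs_def)
qed

lemma flat_rel_if_absorbs_same_length:
  assumes "\<alpha> \<in> L" "\<beta> \<in> L" "length \<alpha> = length \<beta>" "absorbs \<alpha> \<beta>"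
  shows "(\<alpha>, \<beta>) \<in> flat_rel E L"
  using assms append_mem_if_absorbs_same_length absorbs_sym_same_length[OF assms]
  by (metis flat_rel_iff)

lemma absorbs_iff_flat_rel:
  assumes "\<alpha> \<in> L" "\<beta> \<in> L"
  shows "absorbs \<alpha> \<beta> \<longleftrightarrow> (\<exists>\<gamma>. (\<beta> @ \<gamma>, \<alpha>) \<in> flat_rel E L)"
proof
  assume abs: "absorbs \<alpha> \<beta>"
  show "\<exists>\<gamma>. (\<beta> @ \<gamma>, \<alpha>) \<in> flat_rel E L"
  proof (cases "length \<beta> = length \<alpha>")
    case True
    then have "(\<beta> @ [], \<alpha>) \<in> flat_rel E L"
      using flat_rel_if_absorbs_same_length[OF assms _ abs] by (simp add: flat_rel_iff)
    then show ?thesis by blast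
  next
    case False
    then have less: "length \<beta> < length \<alpha>"
      using length_le_if_absorbs[OF assms abs] by simp
    then obtain \<gamma> where \<gamma>: "subseq \<gamma> \<alpha>" "length \<gamma> = length \<alpha> - length \<beta>" "\<beta> @ \<gamma> \<in> L"
      using strong_exchange[OF assms] by blast
    \<comment> \<open>The letters of \<gamma> lie in \<alpha>, which absorbs itself.\<close>
    then have "absorbs \<alpha> (\<beta> @ \<gamma>)"
      using abs absorbs_prefix[of \<alpha> "[]"]
      by (auto simp: absorbs_def dest: list_emb_set)
    then have "(\<alpha>, \<beta> @ \<gamma>) \<in> flat_rel E L"
      using flat_rel_if_absorbs_same_length[OF assms(1) \<gamma>(3)] less \<gamma>(2) by simp
    then show ?thesis by (auto simp: flat_rel_iff)
  qed
next
  assume "\<exists>\<gamma>. (\<beta> @ \<gamma>, \<alpha>) \<in> flat_rel E L"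
  \<comment> \<open>\<open>\<beta> @ \<gamma>\<close> absorbs its prefix \<beta>, and equivalent
    words accept the same letters.\<close>
  then show "absorbs \<alpha> \<beta>"
    using absorbs_prefix by (auto simp: flat_rel_iff absorbs_def)
qed

lemma le_flat_poset_iff_absorbs:
  assumes "\<alpha> \<in> L" "\<beta> \<in> L"
  shows "flat_of E L \<beta> \<sqsubseteq>\<^bsub>flat_poset E L\<^esub> flat_of E L \<alpha> \<longleftrightarrow> absorbs \<alpha> \<beta>"
  unfolding absorbs_iff_flat_rel[OF assms]
  using flat_le_flat_of_iff[OF language assms(2,1)]
  by (simp add: flat_poset_def) (meson flat_rel_iff words_if_append_mem)

lemma absorbs_trans:
  assumes "\<alpha> \<in> L" "\<beta> \<in> L" "\<gamma> \<in> L" "absorbs \<alpha> \<beta>" "absorbs \<beta> \<gamma>"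
  shows "absorbs \<alpha> \<gamma>"
proof -
  obtain \<delta> \<epsilon> where "(\<beta> @ \<delta>, \<alpha>) \<in> flat_rel E L" "(\<gamma> @ \<epsilon>, \<beta>) \<in> flat_rel E L"
    using assms absorbs_iff_flat_rel by blast
  \<comment> \<open>Equivalence survives appending \<delta> to both
    \<open>\<gamma> @ \<epsilon>\<close> and \<beta>.\<close>
  then have "(\<gamma> @ (\<epsilon> @ \<delta>), \<alpha>) \<in> flat_rel E L"
    by (auto simp: flat_rel_iff)
  then show ?thesis using assms absorbs_iff_flat_rel by blast
qed

lemma absorbs_snoc:
  assumes "\<alpha> @ [y] \<in> L" "\<beta> \<in> L" "absorbs \<alpha> \<beta>"
  shows "absorbs (\<alpha> @ [y]) (\<beta> @ [y])"
proof -
  have "\<alpha> \<in> L" using assms(1) prefix_closed by blast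
  then have "absorbs (\<alpha> @ [y]) \<beta>"
    using absorbs_trans[OF assms(1) _ assms(2) absorbs_prefix assms(3)] by simp
  moreover have "\<alpha> @ [y, y] \<notin> L" using distinct_if_mem by fastforce
  ultimately show ?thesis by (auto simp: absorbs_def)
qed

text \<open>Fill \<alpha>y up to the length of \<alpha>\<beta>\<gamma>y: as \<alpha> and y are used
  up, the added word is \<beta>\<gamma>, so \<alpha>y\<beta> is in \<open>L\<close>. It is one
  letter longer than \<alpha>\<beta>, and the only letter that exchange can append there is
  y.\<close>

lemma interval_property:
  assumes y: "\<alpha> @ [y] \<in> L" and long: "\<alpha> @ \<beta> @ \<gamma> @ [y] \<in> L"
  shows "\<alpha> @ \<beta> @ [y] \<in> L"
\<comment> \<open>Strong exchange requires a strictly longer word, hence the case split.\<close>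
proof (cases "\<beta> @ \<gamma> = []")
  case False
  obtain \<rho> where \<rho>: "subseq \<rho> (\<alpha> @ \<beta> @ \<gamma> @ [y])" "length \<rho> = length (\<beta> @ \<gamma>)"
    "(\<alpha> @ [y]) @ \<rho> \<in> L"
    using strong_exchange[OF long y] False by auto
  have disj: "distinct ((\<alpha> @ [y]) @ \<rho>)" using \<rho>(3) distinct_if_mem by blast
  obtain \<rho>1 \<rho>2 \<rho>3 where split: "\<rho> = \<rho>1 @ \<rho>2 @ \<rho>3" "subseq \<rho>1 \<alpha>" "subseq \<rho>2 (\<beta> @ \<gamma>)"
    "subseq \<rho>3 [y]"
    using \<rho>(1) subseq_append_iff[of \<rho> \<alpha> "(\<beta> @ \<gamma>) @ [y]"] subseq_append_iff[of _ "\<beta> @ \<gamma>" "[y]"]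
    by auto
  have "\<rho>1 = []"
    using split(1,2) disj by (cases \<rho>1) (auto dest: list_emb_set)
  moreover have "\<rho>3 = []"
    using split(1,4) disj by (cases \<rho>3) (auto dest: list_emb_set)
  ultimately have "\<rho> = \<beta> @ \<gamma>"
    using split \<rho>(2) subseq_same_length[of \<rho>2 "\<beta> @ \<gamma>"] by simp
  then have ext: "\<alpha> @ [y] @ \<beta> \<in> L" using \<rho>(3) prefix_closed[of "\<alpha> @ [y] @ \<beta>" \<gamma>] by simp
  have base: "\<alpha> @ \<beta> \<in> L" using long prefix_closed[of "\<alpha> @ \<beta>" "\<gamma> @ [y]"] by simp
  obtain x where x: "x \<in> set (\<alpha> @ [y] @ \<beta>)" "(\<alpha> @ \<beta>) @ [x] \<in> L"
    using exchange_letter[OF ext base] by auto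
  have "x = y" using x distinct_if_mem[OF x(2)] by auto
  then show ?thesis using x(2) by simp
qed (use y in simp)

text \<open>Passing to equivalent words turns the interval property for prefixes into one for flats
  [\<alpha>] \<le> [\<beta>] \<le> [\<gamma>].\<close>

lemma interval_property_absorbs:
  assumes "\<alpha> \<in> L" "\<beta> \<in> L" "\<gamma> \<in> L" "absorbs \<beta> \<alpha>" "absorbs \<gamma> \<beta>"
    and "\<alpha> @ [y] \<in> L" "\<gamma> @ [y] \<in> L"
  shows "\<beta> @ [y] \<in> L"
proof -
  obtain \<delta> \<epsilon> where rel: "(\<alpha> @ \<delta>, \<beta>) \<in> flat_rel E L" "(\<beta> @ \<epsilon>, \<gamma>) \<in> flat_rel E L"
    using assms absorbs_iff_flat_rel by blast
  then have "\<alpha> @ \<delta> @ \<epsilon> @ [y] \<in> L" using assms(7) by (auto simp: flat_rel_iff)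
  then have "\<alpha> @ \<delta> @ [y] \<in> L" using interval_property[OF assms(6)] by blast
  then show ?thesis using rel(1) by (auto simp: flat_rel_iff)
qed

section \<open>Composition and the LRB laws\<close>

lemma comp_Nil: "greedoid_comp L \<alpha> [] = \<alpha>"
  by (simp add: greedoid_comp_def)

lemma comp_snoc:
  "greedoid_comp L \<alpha> (\<beta> @ [y]) =
    (if greedoid_comp L \<alpha> \<beta> @ [y] \<in> L then greedoid_comp L \<alpha> \<beta> @ [y] else greedoid_comp L \<alpha> \<beta>)"
  by (simp add: greedoid_comp_def)

lemma comp_append: "greedoid_comp L \<alpha> (\<beta> @ \<gamma>) = greedoid_comp L (greedoid_comp L \<alpha> \<beta>) \<gamma>"
  by (simp add: greedoid_comp_def)

lemma comp_mem: "\<alpha> \<in> L \<Longrightarrow> greedoid_comp L \<alpha> \<beta> \<in> L"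
  by (induction \<beta> rule: rev_induct) (auto simp: comp_Nil comp_snoc)

lemma comp_extends: "\<exists>\<gamma>. greedoid_comp L \<alpha> \<beta> = \<alpha> @ \<gamma> \<and> set \<gamma> \<subseteq> set \<beta>"
  by (induction \<beta> rule: rev_induct) (auto simp: comp_Nil comp_snoc)

lemma Nil_comp: "\<beta> \<in> L \<Longrightarrow> greedoid_comp L [] \<beta> = \<beta>"
  by (induction \<beta> rule: rev_induct) (simp_all add: comp_Nil comp_snoc prefix_closed)

lemma comp_eq_left_iff: "greedoid_comp L \<alpha> \<beta> = \<alpha> \<longleftrightarrow> absorbs \<alpha> \<beta>"
proof (induction \<beta> rule: rev_induct)
  case (snoc y \<beta>)
  \<comment> \<open>A word that has grown past \<alpha> never shrinks back to it.\<close>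
  show ?case
    using snoc.IH comp_extends[of \<alpha> \<beta>] by (auto simp: comp_snoc absorbs_append_iff absorbs_def)
qed (simp add: comp_Nil absorbs_def)

lemma comp_absorbs_left: "absorbs (greedoid_comp L \<alpha> \<beta>) \<alpha>"
  using comp_extends[of \<alpha> \<beta>] absorbs_prefix by auto

text \<open>An appended letter cannot recur, and a word of \<open>L\<close> once absorbed stays
  absorbed by \<open>absorbs_snoc\<close>. Membership of \<beta> matters: a single rejected letter
  may become appendable when the left word grows.\<close>

lemma comp_absorbs_right:
  assumes "\<alpha> \<in> L"
  shows "\<beta> \<in> L \<Longrightarrow> absorbs (greedoid_comp L \<alpha> \<beta>) \<beta>"
proof (induction \<beta> rule: rev_induct)
  case (snoc y \<beta>)
  have "\<beta> \<in> L" using snoc.prems prefix_closed by blast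
  then show ?case
    using snoc.IH absorbs_snoc by (auto simp: comp_snoc absorbs_append_iff absorbs_def)
qed (simp add: absorbs_def)

lemma absorbs_comp: "absorbs \<delta> \<alpha> \<Longrightarrow> absorbs \<delta> \<beta> \<Longrightarrow> absorbs \<delta> (greedoid_comp L \<alpha> \<beta>)"
  using comp_extends[of \<alpha> \<beta>] by (fastforce simp: absorbs_def)

text \<open>
  Writing \<open>\<beta> \<circ> \<gamma> = \<beta>\<gamma>'\<close>, the composition \<open>w \<circ> (\<beta> \<circ> \<gamma>)\<close> equals \<open>w \<circ> \<gamma>'\<close>; the letters of
  \<open>\<gamma>\<close> missing in \<open>\<gamma>'\<close> cannot be appended on the left either, by the interval property.
\<close>

lemma comp_comp_if_absorbs:
  assumes "w \<in> L" "\<beta> \<in> L" "absorbs w \<beta>" and "\<gamma> \<in> L"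
  shows "greedoid_comp L w (greedoid_comp L \<beta> \<gamma>) = greedoid_comp L w \<gamma> \<and>
    absorbs (greedoid_comp L w \<gamma>) (greedoid_comp L \<beta> \<gamma>)"
  using assms(4)
proof (induction \<gamma> rule: rev_induct)
  case Nil
  then show ?case using assms(3) by (simp add: comp_Nil comp_eq_left_iff)
next
  case (snoc y \<gamma>)
  let ?w = "greedoid_comp L w \<gamma>" and ?v = "greedoid_comp L \<beta> \<gamma>"
  have mem: "?w \<in> L" "?v \<in> L" "\<gamma> \<in> L"
    using comp_mem assms snoc.prems prefix_closed by blast+
  have IH: "greedoid_comp L w ?v = ?w" "absorbs ?w ?v"
    using snoc.IH mem by auto
  show ?case
  proof (cases "?v @ [y] \<in> L")
    case True
    \<comment> \<open>Either y is appended to \<open>?w\<close> too, or it is rejected and thereby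
      absorbed.\<close>
    have "absorbs (greedoid_comp L w (\<gamma> @ [y])) (?v @ [y])"
      using absorbs_snoc[OF _ mem(2) IH(2)] IH(2)
      by (auto simp: comp_snoc absorbs_append_iff absorbs_def)
    then show ?thesis using True IH(1) by (simp add: comp_snoc)
  next
    case False
    \<comment> \<open>The interval property is applied to the chain [\<gamma>] \<le>
      [\<open>?v\<close>] \<le> [\<open>?w\<close>].\<close>
    have "?w @ [y] \<notin> L"
      using interval_property_absorbs[OF mem(3,2,1) comp_absorbs_right[OF assms(2) mem(3)] IH(2)
        snoc.prems] False by blast
    then show ?thesis using False IH by (simp add: comp_snoc)
  qed
qed

text \<open>Let w = \<alpha> \<circ> \<beta> and \<beta> \<circ> \<gamma> = \<beta>\<delta>. Since w
  absorbs \<beta>, w \<circ> \<gamma> = w \<circ> (\<beta>\<delta>), where the leading \<beta>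
  leaves w unchanged.\<close>

lemma comp_assoc:
  assumes "\<alpha> \<in> L" "\<beta> \<in> L" "\<gamma> \<in> L"
  shows "greedoid_comp L (greedoid_comp L \<alpha> \<beta>) \<gamma> = greedoid_comp L \<alpha> (greedoid_comp L \<beta> \<gamma>)"
proof -
  obtain \<delta> where \<delta>: "greedoid_comp L \<beta> \<gamma> = \<beta> @ \<delta>" using comp_extends by blast
  let ?w = "greedoid_comp L \<alpha> \<beta>"
  have w: "?w \<in> L" "absorbs ?w \<beta>" using assms comp_mem comp_absorbs_right by auto
  have "greedoid_comp L ?w \<gamma> = greedoid_comp L ?w (\<beta> @ \<delta>)"
    using comp_comp_if_absorbs[OF w(1) assms(2) w(2) assms(3)] \<delta> by simp
  also have "\<dots> = greedoid_comp L ?w \<delta>"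
    using w(2) comp_eq_left_iff[of ?w \<beta>] by (simp add: comp_append)
  finally show ?thesis using \<delta> by (simp add: comp_append)
qed

text \<open>Idempotence and left regularity say that a word absorbs itself and that a composite
  absorbs its left factor.\<close>

lemma LRB_semigroup_greedoid_monoid:
  assumes "finite E"
  shows "LRB_semigroup (greedoid_monoid L)"
proof
  show "finite (carrier (greedoid_monoid L))"
    using finite_subset[OF language finite_words[OF assms]] by (simp add: greedoid_monoid_def)
next
  fix \<alpha> \<beta> assume "\<alpha> \<in> carrier (greedoid_monoid L)" "\<beta> \<in> carrier (greedoid_monoid L)"
  show "\<alpha> \<otimes>\<^bsub>greedoid_monoid L\<^esub> \<beta> \<otimes>\<^bsub>greedoid_monoid L\<^esub> \<alpha> = \<alpha> \<otimes>\<^bsub>greedoid_monoid L\<^esub> \<beta>"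
    by (simp add: greedoid_monoid_def comp_eq_left_iff comp_absorbs_left)
qed (use absorbs_prefix[of _ "[]"] in \<open>auto simp: greedoid_monoid_def comp_mem comp_assoc Nil_mem
    Nil_comp comp_Nil comp_eq_left_iff\<close>)

section \<open>The lattice of flats\<close>

lemma carrier_flat_poset: "carrier (flat_poset E L) = flat_of E L ` L"
  by (auto simp: flat_poset_def quotient_def flat_of_def)

lemma partial_order_flat_poset: "partial_order (flat_poset E L)"
proof
  fix X assume "X \<in> carrier (flat_poset E L)"
  then obtain \<alpha> where "\<alpha> \<in> L" "X = flat_of E L \<alpha>" by (auto simp: carrier_flat_poset)
  then show "X \<sqsubseteq>\<^bsub>flat_poset E L\<^esub> X"
    using absorbs_prefix[of \<alpha> "[]"] by (simp add: le_flat_poset_iff_absorbs)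
next
  fix X Y assume le: "X \<sqsubseteq>\<^bsub>flat_poset E L\<^esub> Y" "Y \<sqsubseteq>\<^bsub>flat_poset E L\<^esub> X"
  assume "X \<in> carrier (flat_poset E L)" "Y \<in> carrier (flat_poset E L)"
  then obtain \<alpha> \<beta> where \<alpha>: "\<alpha> \<in> L" "X = flat_of E L \<alpha>" and \<beta>: "\<beta> \<in> L" "Y = flat_of E L \<beta>"
    by (auto simp: carrier_flat_poset)
  then have "absorbs \<beta> \<alpha>" "absorbs \<alpha> \<beta>"
    using le by (simp_all add: le_flat_poset_iff_absorbs)
  \<comment> \<open>Absorption bounds lengths, so mutual absorption makes them equal.\<close>
  moreover from this have "length \<alpha> = length \<beta>"
    using length_le_if_absorbs[of \<alpha> \<beta>] length_le_if_absorbs[of \<beta> \<alpha>] \<alpha>(1) \<beta>(1) by simp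
  ultimately show "X .=\<^bsub>flat_poset E L\<^esub> Y"
    using flat_rel_if_absorbs_same_length[of \<alpha> \<beta>] \<alpha> \<beta> by (simp add: flat_poset_def flat_of_eq_iff)
next
  fix X Y Z assume le: "X \<sqsubseteq>\<^bsub>flat_poset E L\<^esub> Y" "Y \<sqsubseteq>\<^bsub>flat_poset E L\<^esub> Z"
  assume "X \<in> carrier (flat_poset E L)" "Y \<in> carrier (flat_poset E L)" "Z \<in> carrier (flat_poset E L)"
  then obtain \<alpha> \<beta> \<gamma> where "\<alpha> \<in> L" "X = flat_of E L \<alpha>" "\<beta> \<in> L" "Y = flat_of E L \<beta>"
    "\<gamma> \<in> L" "Z = flat_of E L \<gamma>"
    by (auto simp: carrier_flat_poset)
  then show "X \<sqsubseteq>\<^bsub>flat_poset E L\<^esub> Z"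
    using le absorbs_trans[of \<gamma> \<beta> \<alpha>] by (simp add: le_flat_poset_iff_absorbs)
qed (simp_all add: flat_poset_def)

text \<open>An upper bound is the flat of a word absorbing both factors, and such a word absorbs
  every letter of the composite.\<close>

lemma least_flat_of_comp:
  assumes "\<alpha> \<in> L" "\<beta> \<in> L"
  shows "least (flat_poset E L) (flat_of E L (greedoid_comp L \<alpha> \<beta>))
    (Upper (flat_poset E L) {flat_of E L \<alpha>, flat_of E L \<beta>})"
proof (rule least_UpperI)
  fix X assume "X \<in> {flat_of E L \<alpha>, flat_of E L \<beta>}"
  then show "X \<sqsubseteq>\<^bsub>flat_poset E L\<^esub> flat_of E L (greedoid_comp L \<alpha> \<beta>)"
    using assms by (elim insertE emptyE)
      (simp_all add: le_flat_poset_iff_absorbs comp_mem comp_absorbs_left comp_absorbs_right)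
next
  fix Y assume Y: "Y \<in> Upper (flat_poset E L) {flat_of E L \<alpha>, flat_of E L \<beta>}"
  obtain \<delta> where \<delta>: "Y = flat_of E L \<delta>" "\<delta> \<in> L"
    using subsetD[OF Upper_closed Y] unfolding carrier_flat_poset by (rule imageE)
  have "absorbs \<delta> \<alpha>" "absorbs \<delta> \<beta>"
    using Upper_memD[OF Y, of "flat_of E L \<alpha>"] Upper_memD[OF Y, of "flat_of E L \<beta>"] assms \<delta>
    by (simp_all add: le_flat_poset_iff_absorbs carrier_flat_poset)
  then show "flat_of E L (greedoid_comp L \<alpha> \<beta>) \<sqsubseteq>\<^bsub>flat_poset E L\<^esub> Y"
    using assms \<delta> by (simp add: le_flat_poset_iff_absorbs comp_mem absorbs_comp)
qed (use assms comp_mem in \<open>simp_all add: carrier_flat_poset\<close>)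

lemma greatest_common_lower_flat:
  assumes "finite E" "\<alpha> \<in> L" "\<beta> \<in> L"
  shows "\<exists>X. greatest (flat_poset E L) X (Lower (flat_poset E L) {flat_of E L \<alpha>, flat_of E L \<beta>})"
proof -
  \<comment> \<open>Representatives of the common lower bounds; this set is closed under
    composition.\<close>
  let ?B = "{\<gamma> \<in> L. absorbs \<alpha> \<gamma> \<and> absorbs \<beta> \<gamma>}"
  have "finite ?B" using finite_subset[OF language finite_words[OF assms(1)]] by simp
  moreover have "[] \<in> ?B" using Nil_mem by (simp add: absorbs_def)
  ultimately have fin: "finite (length ` ?B)" and "length ` ?B \<noteq> {}" by blast+
  then have "Max (length ` ?B) \<in> length ` ?B" by (rule Max_in)
  then obtain \<gamma> where \<gamma>: "\<gamma> \<in> ?B" and length_\<gamma>: "Max (length ` ?B) = length \<gamma>" by (rule imageE)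
  have max: "length \<delta> \<le> length \<gamma>" if "\<delta> \<in> ?B" for \<delta>
    using Max_ge[OF fin imageI[OF that]] length_\<gamma> by simp
  have absorbed: "absorbs \<gamma> \<delta>" if "\<delta> \<in> ?B" for \<delta>
  proof -
    have "greedoid_comp L \<gamma> \<delta> \<in> ?B" using \<gamma> that by (simp add: comp_mem absorbs_comp)
    then have "length (greedoid_comp L \<gamma> \<delta>) \<le> length \<gamma>" by (rule max)
    \<comment> \<open>The composite starts with \<gamma>, so being no longer it equals
      \<gamma>.\<close>
    then have "greedoid_comp L \<gamma> \<delta> = \<gamma>" using comp_extends[of \<gamma> \<delta>] by auto
    then show ?thesis by (simp add: comp_eq_left_iff)
  qed
  have "greatest (flat_poset E L) (flat_of E L \<gamma>)
      (Lower (flat_poset E L) {flat_of E L \<alpha>, flat_of E L \<beta>})"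
  proof (rule greatest_LowerI)
    fix X assume "X \<in> {flat_of E L \<alpha>, flat_of E L \<beta>}"
    then show "flat_of E L \<gamma> \<sqsubseteq>\<^bsub>flat_poset E L\<^esub> X"
      using assms(2,3) \<gamma> by (elim insertE emptyE) (simp_all add: le_flat_poset_iff_absorbs)
  next
    fix Y assume Y: "Y \<in> Lower (flat_poset E L) {flat_of E L \<alpha>, flat_of E L \<beta>}"
    obtain \<delta> where \<delta>: "Y = flat_of E L \<delta>" "\<delta> \<in> L"
      using subsetD[OF Lower_closed Y] unfolding carrier_flat_poset by (rule imageE)
    have "absorbs \<alpha> \<delta>" "absorbs \<beta> \<delta>"
      using Lower_memD[OF Y, of "flat_of E L \<alpha>"] Lower_memD[OF Y, of "flat_of E L \<beta>"] assms(2,3) \<delta>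
      by (simp_all add: le_flat_poset_iff_absorbs carrier_flat_poset)
    then show "Y \<sqsubseteq>\<^bsub>flat_poset E L\<^esub> flat_of E L \<gamma>"
      using absorbed \<gamma> \<delta> by (simp add: le_flat_poset_iff_absorbs)
  qed (use assms(2,3) \<gamma> in \<open>simp_all add: carrier_flat_poset\<close>)
  then show ?thesis ..
qed

lemma lattice_flat_poset:
  assumes "finite E"
  shows "lattice (flat_poset E L)"
proof -
  interpret partial_order "flat_poset E L" by (rule partial_order_flat_poset)
  show ?thesis
  proof
    fix X Y assume "X \<in> carrier (flat_poset E L)" "Y \<in> carrier (flat_poset E L)"
    then obtain \<alpha> \<beta> where "\<alpha> \<in> L" "X = flat_of E L \<alpha>" "\<beta> \<in> L" "Y = flat_of E L \<beta>"
      by (auto simp: carrier_flat_poset)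
    then show "\<exists>s. least (flat_poset E L) s (Upper (flat_poset E L) {X, Y})"
      and "\<exists>s. greatest (flat_poset E L) s (Lower (flat_poset E L) {X, Y})"
      using least_flat_of_comp greatest_common_lower_flat[OF assms] by blast+
  qed
qed

text \<open>\<open>join\<close> chooses some least upper bound; uniqueness identifies it with the
  flat of the composite.\<close>

lemma flat_of_comp:
  assumes "\<alpha> \<in> L" "\<beta> \<in> L"
  shows "flat_of E L (greedoid_comp L \<alpha> \<beta>) =
    flat_of E L \<alpha> \<squnion>\<^bsub>flat_poset E L\<^esub> flat_of E L \<beta>"
proof -
  interpret partial_order "flat_poset E L" by (rule partial_order_flat_poset)
  show ?thesis
    unfolding join_def sup_def
    by (rule least_unique[OF least_flat_of_comp[OF assms] someI]) (rule least_flat_of_comp[OF assms])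
qed

section \<open>The support map\<close>

lemma isotone_flat_of:
  assumes "finite E"
  shows "isotone (LRB_order (greedoid_monoid L)) (flat_poset E L) (flat_of E L)"
proof -
  interpret ord: partial_order "LRB_order (greedoid_monoid L)"
    by (rule partial_order_LRB_order[OF LRB_semigroup_greedoid_monoid[OF assms]])
  interpret flats: partial_order "flat_poset E L" by (rule partial_order_flat_poset)
  show ?thesis
  proof (rule isotoneI)
    fix \<alpha> \<beta> assume "\<alpha> \<in> carrier (LRB_order (greedoid_monoid L))"
      "\<beta> \<in> carrier (LRB_order (greedoid_monoid L))" "\<alpha> \<sqsubseteq>\<^bsub>LRB_order (greedoid_monoid L)\<^esub> \<beta>"
    \<comment> \<open>Here \<beta> = \<alpha> \<circ> \<beta>, and the composite absorbs
      \<alpha>.\<close>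
    then show "flat_of E L \<alpha> \<sqsubseteq>\<^bsub>flat_poset E L\<^esub> flat_of E L \<beta>"
      using comp_absorbs_left[of \<alpha> \<beta>]
      by (simp add: LRB_order_def greedoid_monoid_def le_flat_poset_iff_absorbs)
  qed unfold_locales
qed

text \<open>Both sides of the last clause of \<open>support_lattice\<close> express that the first
  word absorbs the second.\<close>

lemma support_lattice_flat_poset:
  assumes "finite E"
  shows "support_lattice (greedoid_monoid L) (flat_poset E L) (flat_of E L)"
  unfolding support_lattice_def
  using lattice_flat_poset[OF assms] isotone_flat_of[OF assms] flat_of_comp
  by (simp add: greedoid_monoid_def carrier_flat_poset comp_eq_left_iff
      le_flat_poset_iff_absorbs)

end

theorem theorem4p15:
  fixes E :: "'a set" and L :: "'a list set"
  assumes "finite E" and "interval_greedoid E L"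
  shows "LRB_semigroup (greedoid_monoid L) \<and>
    support_lattice (greedoid_monoid L) (flat_poset E L) (flat_of E L)"
  using interval_greedoid.LRB_semigroup_greedoid_monoid[OF assms(2,1)]
    interval_greedoid.support_lattice_flat_poset[OF assms(2,1)] by blast

end
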